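(* (Geometric Newton-Gregory backward interpolation formula.) Let $n$ be a positive integer, let $a,h\in\mathbb{C}(G)$ with $h\neq1$, put $b=a\oplus e^n\odot h$, and let $f$ be a $\mathbb{C}(G)$-valued function taking the values $f(a\oplus e^n\odot h),f(a\oplus e^{n-1}\odot h),\dots,f(a)$ at the $n+1$ geometrically equidistant points $a\oplus e^n\odot h,a\oplus e^{n-1}\odot h,\dots,a$. Let $$\begin{aligned}P_n(x)=\;&A_0\oplus A_1\odot(x\ominus a\ominus e^n\odot h)\oplus A_2\odot(x\ominus a\ominus e^n\odot h)\odot(x\ominus a\ominus e^{n-1}\odot h)\oplus\cdots\\&\oplus A_n\odot(x\ominus a\ominus e^n\odot h)\odot(x\ominus a\ominus e^{n-1}\odot h)\odot\cdots\odot(x\ominus a\ominus h)\end{aligned}$$ be the geometric polynomial whose coefficients $A_0,\dots,A_n\in\mathbb{C}(G)$ are determined so that $P_n(a\oplus e^k\odot h)=f(a\oplus e^k\odot h)$ for $k=n,n-1,\dots,0$. Then $$\begin{aligned}P_n(x)=\;&f(b)\oplus\bigl(\nabla_Gf(b)\oslash h\bigr)\odot(x\ominus a\ominus e^n\odot h)\\&\oplus\bigl(\nabla_G^2f(b)\oslash(2!_G\odot h^{2_G})\bigr)\odot(x\ominus a\ominus e^n\odot h)\odot(x\ominus a\ominus e^{n-1}\odot h)\oplus\cdots\\&\oplus\bigl(\nabla_G^nf(b)\oslash(n!_G\odot h^{n_G})\bigr)\odot(x\ominus a\ominus e^n\odot h)\odot(x\ominus a\ominus e^{n-1}\odot h)\odot\cdots\odot(x\ominus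 a\ominus h).\end{aligned}$$ Equivalently, writing $u=(x\ominus b)\oslash h$, i.e. $x=a\oplus e^n\odot h\oplus u\odot h$, $$\begin{aligned}P_n(x)=\;&f(b)\oplus u\odot\nabla_Gf(b)\oplus\bigl((u\odot(u\oplus e))\oslash2!_G\bigr)\odot\nabla_G^2f(b)\oplus\cdots\\&\oplus\bigl((u\odot(u\oplus e)\odot(u\oplus e^2)\odot\cdots\odot(u\oplus e^{n-1}))\oslash n!_G\bigr)\odot\nabla_G^nf(b).\end{aligned}$$
   Context: Geometric complex numbers: $\mathbb{C}(G)=\{e^z: z\in\mathbb{C}\}$, where the generator $z\mapsto e^z$ is treated as a bijection from $\mathbb{C}$ onto $\mathbb{C}(G)$ with inverse $\ln$ (so an element of $\mathbb{C}(G)$ determines its exponent $z$). Operations: $e^z\oplus e^w=e^{z+w}$, $e^z\ominus e^w=e^{z-w}$, $e^z\odot e^w=e^{zw}$, and $e^z\oslash e^w=e^{z/w}$ for $w\ne0$. $(\mathbb{C}(G),\oplus,\odot)$ is a field with geometric zero $1=e^0$ and geometric identity $e=e^1$. $\odot$ binds more tightly than $\oplus,\ominus$. $h^{k_G}=h\odot\cdots\odot h$ ($k$ factors). Geometric factorial: $k!_G=e^{k!}$. Geometric backward differences with step $h$: $\nabla_Gf(x)=f(x)\ominus f(x\ominus h)$ and $\nabla_G^{k}f(x)=\nabla_G^{k-1}f(x)\ominus\nabla_G^{k-1}f(x\ominus h)$ for $k\ge2$. *)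

theory Defs
  imports Complex_Main "HOL-Library.FuncSet"
begin

text \<open>
  The generator \<open>z \<mapsto> e\<^sup>z\<close> is meant to be a bijection from the complex numbers onto the geometric
  complex numbers: an element of the latter determines its exponent, even though
  \<^const>\<open>exp\<close> is \<open>2\<pi>\<i>\<close>-periodic. Hence they are a datatype of formal exponentials
  and not a subset of the complex plane; \<open>gln\<close> is the inverse of the generator.
\<close>

datatype gcomplex = gexp (gln: complex)

lemma gln_eq_0_iff: "gln x = 0 \<longleftrightarrow> x = gexp 0"
  by (cases x) simp

text \<open>
  With the geometric operations the formal exponentials are an instance of the library's class
  of fields. So \<open>0\<close> is the geometric zero \<open>e\<^sup>0\<close> (the number called \<open>1\<close> classically),
  \<open>1\<close> is the geometric identity \<open>e\<^sup>1\<close>, and \<open>\<Sum>\<close>, \<open>\<Prod>\<close> and \<open>h ^ k\<close> are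
  iterated geometric sums, products and the geometric power. As usual in this class, division
  by the geometric zero yields the geometric zero.
\<close>

instantiation gcomplex :: field
begin

definition "0 = gexp 0"
definition "1 = gexp 1"
definition "x + y = gexp (gln x + gln y)"
definition "x - y = gexp (gln x - gln y)"
definition "- x = gexp (- gln x)"
definition "x * y = gexp (gln x * gln y)"
definition "x div y = gexp (gln x / gln y)"
definition "inverse x = gexp (inverse (gln x))"

instance
  by standard
    (auto simp: zero_gcomplex_def one_gcomplex_def plus_gcomplex_def minus_gcomplex_def
      uminus_gcomplex_def times_gcomplex_def divide_gcomplex_def inverse_gcomplex_def
      algebra_simps divide_inverse gcomplex.expand gln_eq_0_iff)

end

abbreviation gadd :: "gcomplex \<Rightarrow> gcomplex \<Rightarrow> gcomplex" (infixl "\<oplus>" 65)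
  where "x \<oplus> y \<equiv> x + y"

abbreviation gsub :: "gcomplex \<Rightarrow> gcomplex \<Rightarrow> gcomplex" (infixl "\<ominus>" 65)
  where "x \<ominus> y \<equiv> x - y"

abbreviation gmult :: "gcomplex \<Rightarrow> gcomplex \<Rightarrow> gcomplex" (infixl "\<odot>" 70)
  where "x \<odot> y \<equiv> x * y"

abbreviation gdiv :: "gcomplex \<Rightarrow> gcomplex \<Rightarrow> gcomplex" (infixl "\<oslash>" 70)
  where "x \<oslash> y \<equiv> x / y"

lemma gexp_operations:
  "gexp z \<oplus> gexp w = gexp (z + w)"
  "gexp z \<ominus> gexp w = gexp (z - w)"
  "gexp z \<odot> gexp w = gexp (z * w)"
  "gexp z \<oslash> gexp w = gexp (z / w)"
  by (simp_all add: plus_gcomplex_def minus_gcomplex_def times_gcomplex_def divide_gcomplex_def)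

definition gfact :: "nat \<Rightarrow> gcomplex"
  where "gfact k = gexp (fact k)"

primrec gbdiff :: "gcomplex \<Rightarrow> nat \<Rightarrow> (gcomplex \<Rightarrow> gcomplex) \<Rightarrow> gcomplex \<Rightarrow> gcomplex"
  where
    "gbdiff h 0 f = f"
  | "gbdiff h (Suc k) f = (\<lambda>x. gbdiff h k f x \<ominus> gbdiff h k f (x \<ominus> h))"

text \<open>
  The product of the \<open>k\<close> factors \<open>x \<ominus> a \<ominus> e\<^sup>n \<odot> h\<close>, \<open>x \<ominus> a \<ominus> e\<^sup>n\<^sup>-\<^sup>1 \<odot> h\<close> and so on;
  it is only used for \<open>k \<le> n\<close>, so that the subtraction of natural numbers does not truncate.
\<close>

definition gnodes_prod :: "gcomplex \<Rightarrow> gcomplex \<Rightarrow> nat \<Rightarrow> nat \<Rightarrow> gcomplex \<Rightarrow> gcomplex"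
  where "gnodes_prod a h n k x = (\<Prod>j<k. x \<ominus> a \<ominus> gexp (of_nat (n - j)) \<odot> h)"

definition gnewton_poly ::
    "gcomplex \<Rightarrow> gcomplex \<Rightarrow> nat \<Rightarrow> (nat \<Rightarrow> gcomplex) \<Rightarrow> gcomplex \<Rightarrow> gcomplex"
  where "gnewton_poly a h n A x = A 0 \<oplus> (\<Sum>k=1..n. A k \<odot> gnodes_prod a h n k x)"

end

(* In the field of geometric complex numbers put x = b + u h. The node product with k factors is
   h^k times the rising factorial u (u + 1) ... (u + k - 1), and at the node u = -m it is
   (-h)^k k! (m choose k). So the interpolation conditions form a triangular system with nonzero
   diagonal, and the claimed coefficients solve it because the shift x - h acts as
   (identity - backward difference), whose m-th power has a binomial expansion. *)

theory Submission
  imports Defs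
begin

text \<open>Turns the multipliers \<open>gexp (of_nat k)\<close> in the nodes into ordinary field
  numerals, so that general facts about \<open>of_nat\<close> apply.\<close>

lemma gexp_of_nat: "gexp (of_nat n) = of_nat n"
  by (induction n) (simp_all add: zero_gcomplex_def one_gcomplex_def flip: gexp_operations(1))

text \<open>Characteristic zero is inherited from the exponents, since \<open>gexp\<close> is
  injective. It makes factorials invertible and generalized binomials available.\<close>

instance gcomplex :: field_char_0
proof
  show "inj (of_nat :: nat \<Rightarrow> gcomplex)"
    by (rule injI) (simp add: gexp_of_nat[symmetric])
qed

lemma gfact_eq_fact: "gfact k = fact k"
  using gexp_of_nat[of "fact k"] by (simp add: gfact_def)

lemma gnewton_poly_eq_sum: "gnewton_poly a h n A x = (\<Sum>k\<le>n. A k * gnodes_prod a h n k x)"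
  by (simp add: gnewton_poly_def gnodes_prod_def atMost_atLeast0 sum.atLeast_Suc_atMost)

text \<open>Factor j is n h + u h - (n - j) h = h (u + j); \<open>k \<le> n\<close> keeps
  \<open>n - j\<close> from truncating.\<close>

lemma gnodes_prod_eq_pochhammer:
  assumes "k \<le> n"
  shows "gnodes_prod a h n k (a + of_nat n * h + u * h) = h ^ k * pochhammer u k"
proof -
  have "gnodes_prod a h n k (a + of_nat n * h + u * h) = (\<Prod>j<k. h * (u + of_nat j))"
    unfolding gnodes_prod_def gexp_of_nat using assms
    by (intro prod.cong) (auto simp: algebra_simps)
  then show ?thesis
    by (simp add: prod.distrib pochhammer_prod atLeast0LessThan)
qed

lemma pochhammer_minus_of_nat:
  "pochhammer (- of_nat m :: 'a :: field_char_0) k = (- 1) ^ k * fact k * of_nat (m choose k)"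
  by (simp add: binomial_gbinomial gbinomial_pochhammer flip: power_mult_distrib)

text \<open>The shift by -h is the operator I - \<nabla>, and this is the binomial expansion of its
  m-th power.\<close>

lemma backward_shift_expansion:
  "f (x - of_nat m * h) = (\<Sum>k\<le>m. (- 1) ^ k * of_nat (m choose k) * gbdiff h k f x)"
proof (induction m arbitrary: x)
  case 0
  then show ?case by simp
next
  case (Suc m)
  let ?t = "\<lambda>k. (- 1) ^ k * of_nat (m choose k) * gbdiff h k f x"
  let ?s = "\<lambda>k. (- 1) ^ k * of_nat (m choose k) * gbdiff h (Suc k) f x"
  have "f (x - of_nat (Suc m) * h) = f ((x - h) - of_nat m * h)"
    by (simp add: algebra_simps)
  also have "\<dots> = (\<Sum>k\<le>m. (- 1) ^ k * of_nat (m choose k) * gbdiff h k f (x - h))"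
    by (rule Suc.IH)
  also have "\<dots> = (\<Sum>k\<le>m. ?t k - ?s k)"
    by (intro sum.cong) (auto simp: algebra_simps)
  \<comment> \<open>The added term vanishes because \<open>m choose Suc m\<close> is 0; it lines the
    two sums up after an index shift.\<close>
  also have "\<dots> = (\<Sum>k\<le>Suc m. ?t k) - (\<Sum>k\<le>m. ?s k)"
    by (simp add: sum_subtractf)
  also have "\<dots> = ?t 0 + (\<Sum>k\<le>m. ?t (Suc k) - ?s k)"
    by (subst sum.atMost_Suc_shift) (simp add: sum_subtractf)
  \<comment> \<open>Pascal's rule, with the minus sign absorbed into
    \<open>(- 1) ^ Suc k\<close>.\<close>
  also have "(\<Sum>k\<le>m. ?t (Suc k) - ?s k)
      = (\<Sum>k\<le>m. (- 1) ^ Suc k * of_nat (Suc m choose Suc k) * gbdiff h (Suc k) f x)"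
    by (intro sum.cong) (auto simp: algebra_simps)
  also have "?t 0 + \<dots> = (\<Sum>k\<le>Suc m. (- 1) ^ k * of_nat (Suc m choose k) * gbdiff h k f x)"
    by (subst sum.atMost_Suc_shift) simp
  finally show ?case .
qed

text \<open>Forward substitution: in row m the terms with k < m cancel by induction and those with k
  > m by triangularity, so only the diagonal term remains.\<close>

lemma triangular_system_unique:
  fixes A B :: "nat \<Rightarrow> 'a :: idom"
  assumes eq: "\<And>m. m \<le> n \<Longrightarrow> (\<Sum>k\<le>n. A k * c m k) = (\<Sum>k\<le>n. B k * c m k)"
    and zero: "\<And>m k. m < k \<Longrightarrow> k \<le> n \<Longrightarrow> c m k = 0"
    and diag: "\<And>m. m \<le> n \<Longrightarrow> c m m \<noteq> 0"
  shows "m \<le> n \<Longrightarrow> A m = B m"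
proof (induction m rule: less_induct)
  case (less m)
  have "(A k - B k) * c m k = (if k = m then (A m - B m) * c m m else 0)" if "k \<le> n" for k
    using that less.IH[of k] less.prems zero[of m k] by (cases k m rule: linorder_cases) simp_all
  then have "(\<Sum>k\<le>n. (A k - B k) * c m k) = (\<Sum>k\<le>n. if k = m then (A m - B m) * c m m else 0)"
    by (intro sum.cong) auto
  also have "\<dots> = (A m - B m) * c m m"
    using less.prems by simp
  finally have "(\<Sum>k\<le>n. (A k - B k) * c m k) = (A m - B m) * c m m" .
  moreover have "(\<Sum>k\<le>n. (A k - B k) * c m k) = 0"
    using eq[OF less.prems] by (simp add: left_diff_distrib sum_subtractf)
  ultimately show ?case
    using diag[OF less.prems] by simp
qed

text \<open>The node m steps before the last one has u = -m. The factor \<open>m choose k\<close>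
  vanishes for k > m and is 1 for k = m, whence the triangular shape.\<close>

lemma gnodes_prod_at_node:
  assumes "k \<le> n" "m \<le> n"
  shows "gnodes_prod a h n k (a + of_nat (n - m) * h)
    = h ^ k * ((- 1) ^ k * fact k * of_nat (m choose k))"
proof -
  have "a + of_nat (n - m) * h = a + of_nat n * h + (- of_nat m) * h"
    using assms by (simp add: algebra_simps)
  then show ?thesis
    using gnodes_prod_eq_pochhammer[OF assms(1)] by (simp only: pochhammer_minus_of_nat)
qed

lemma gnewton_poly_interpolates:
  assumes "h \<noteq> 0" "k \<le> n"
  shows "gnewton_poly a h n (\<lambda>k. gbdiff h k f (a + of_nat n * h) / (fact k * h ^ k))
    (a + of_nat k * h) = f (a + of_nat k * h)" (is "gnewton_poly a h n ?N _ = _")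
proof -
  \<comment> \<open>Backward differences start at the last node, so nodes are counted from
    there.\<close>
  define m where "m = n - k"
  have m: "m \<le> n" "k = n - m"
    using assms by (auto simp: m_def)
  let ?b = "a + of_nat n * h"
  have "gnewton_poly a h n ?N (a + of_nat k * h)
      = (\<Sum>j\<le>n. (- 1) ^ j * of_nat (m choose j) * gbdiff h j f ?b)"
    unfolding gnewton_poly_eq_sum m(2) using assms m(1)
    by (intro sum.cong) (auto simp: gnodes_prod_at_node simp del: of_nat_diff)
  \<comment> \<open>Binomials with j > m are zero.\<close>
  also have "\<dots> = (\<Sum>j\<le>m. (- 1) ^ j * of_nat (m choose j) * gbdiff h j f ?b)"
    using m(1) by (intro sum.mono_neutral_right) auto
  also have "\<dots> = f (?b - of_nat m * h)"
    by (rule backward_shift_expansion[symmetric])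
  also have "?b - of_nat m * h = a + of_nat k * h"
    using m by (simp add: algebra_simps)
  finally show ?thesis .
qed

lemma gnewton_poly_coeffs_unique:
  assumes "h \<noteq> 0"
    and eq: "\<And>k. k \<le> n \<Longrightarrow>
      gnewton_poly a h n A (a + of_nat k * h) = gnewton_poly a h n B (a + of_nat k * h)"
    and "m \<le> n"
  shows "A m = B m"
\<comment> \<open>Row m is the condition at node n - m; this reversed order makes the matrix lower
  triangular.\<close>
proof (rule triangular_system_unique[where c = "\<lambda>m k. gnodes_prod a h n k (a + of_nat (n - m) * h)"])
  show "(\<Sum>k\<le>n. A k * gnodes_prod a h n k (a + of_nat (n - i) * h))
      = (\<Sum>k\<le>n. B k * gnodes_prod a h n k (a + of_nat (n - i) * h))" if "i \<le> n" for i
    using eq[of "n - i"] by (simp add: gnewton_poly_eq_sum)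
qed (use assms in \<open>auto simp: gnodes_prod_at_node simp del: of_nat_diff\<close>)

lemma gnewton_poly_cong:
  "(\<And>k. k \<le> n \<Longrightarrow> A k = B k) \<Longrightarrow> gnewton_poly a h n A x = gnewton_poly a h n B x"
  by (simp add: gnewton_poly_eq_sum)

lemma pochhammer_eq_times_prod:
  assumes "k \<ge> 1"
  shows "pochhammer u k = u * (\<Prod>j=1..<k. u + of_nat j)"
  using assms by (simp add: pochhammer_prod prod.atLeast_Suc_lessThan)

theorem mainTheorem5:
  fixes n :: nat and a h b :: gcomplex and f :: "gcomplex \<Rightarrow> gcomplex"
  assumes "n \<ge> 1"
    and "h \<noteq> gexp 0"
    and "b = a \<oplus> gexp (of_nat n) \<odot> h"
  shows
    "(\<exists>!A. A \<in> extensional {0..n} \<and>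
        (\<forall>k\<le>n. gnewton_poly a h n A (a \<oplus> gexp (of_nat k) \<odot> h)
              = f (a \<oplus> gexp (of_nat k) \<odot> h))) \<and>
     (\<forall>A. (\<forall>k\<le>n. gnewton_poly a h n A (a \<oplus> gexp (of_nat k) \<odot> h)
                = f (a \<oplus> gexp (of_nat k) \<odot> h)) \<longrightarrow>
        (\<forall>x. gnewton_poly a h n A x =
              f b \<oplus> (\<Sum>k=1..n. (gbdiff h k f b \<oslash> (gfact k \<odot> h ^ k)) \<odot> gnodes_prod a h n k x)) \<and>
        (\<forall>x u. u = (x \<ominus> b) \<oslash> h \<longrightarrow>
              x = a \<oplus> gexp (of_nat n) \<odot> h \<oplus> u \<odot> h \<and>
              gnewton_poly a h n A x =
              f b \<oplus> (\<Sum>k=1..n. ((u \<odot> (\<Prod>j=1..<k. u \<oplus> gexp (of_nat j))) \<oslash> gfact k)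
                              \<odot> gbdiff h k f b)))"
proof -
  have h: "h \<noteq> 0" and b: "b = a + of_nat n * h"
    using assms(2,3) by (simp_all add: zero_gcomplex_def gexp_of_nat)
  let ?interp = "\<lambda>A. \<forall>k\<le>n. gnewton_poly a h n A (a + of_nat k * h) = f (a + of_nat k * h)"
  define N where "N = (\<lambda>k. gbdiff h k f b / (fact k * h ^ k))"
  have N: "?interp N"
    unfolding N_def b using gnewton_poly_interpolates[OF h] by blast
  have unique: "A k = B k" if "?interp A" "?interp B" "k \<le> n" for A B k
    using gnewton_poly_coeffs_unique[OF h _ that(3), of a A B] that(1,2) by simp
  \<comment> \<open>The conditions see only indices up to n, so uniqueness as a function needs the
    fixed default outside \<open>{0..n}\<close>; hence the restriction of \<open>N\<close>.\<close>
  have "\<exists>!A. A \<in> extensional {0..n} \<and> ?interp A"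
  proof (rule ex1I)
    have "gnewton_poly a h n (restrict N {0..n}) x = gnewton_poly a h n N x" for x
      by (rule gnewton_poly_cong) simp
    then show "restrict N {0..n} \<in> extensional {0..n} \<and> ?interp (restrict N {0..n})"
      using N by simp
    show "A = restrict N {0..n}" if "A \<in> extensional {0..n} \<and> ?interp A" for A
      using that unique[of A N] N by (intro extensionalityI[of A "{0..n}"]) auto
  qed
  moreover have poly: "gnewton_poly a h n A x
      = f b + (\<Sum>k=1..n. (gbdiff h k f b / (gfact k * h ^ k)) * gnodes_prod a h n k x)"
    if "?interp A" for A x
  proof -
    have "gnewton_poly a h n A x = gnewton_poly a h n N x"
      by (rule gnewton_poly_cong) (rule unique[OF that N])
    \<comment> \<open>The coefficient \<open>N 0\<close> reduces to \<open>f b\<close>.\<close>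
    then show ?thesis
      by (simp add: gnewton_poly_def N_def gfact_eq_fact)
  qed
  moreover have "x = a + of_nat n * h + u * h \<and> gnewton_poly a h n A x
      = f b + (\<Sum>k=1..n. ((u * (\<Prod>j=1..<k. u + of_nat j)) / gfact k) * gbdiff h k f b)"
    if A: "?interp A" and u: "u = (x - b) / h" for A x u
  proof
    show x: "x = a + of_nat n * h + u * h"
      using h by (simp add: u b)
    have "(gbdiff h k f b / (gfact k * h ^ k)) * gnodes_prod a h n k x
        = ((u * (\<Prod>j=1..<k. u + of_nat j)) / gfact k) * gbdiff h k f b" if "k \<in> {1..n}" for k
    proof -
      \<comment> \<open>The factor \<open>h ^ k\<close> cancels against the denominator of the
        coefficient.\<close>
      have "gnodes_prod a h n k x = h ^ k * (u * (\<Prod>j=1..<k. u + of_nat j))"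
        unfolding x using that
        by (simp only: gnodes_prod_eq_pochhammer pochhammer_eq_times_prod atLeastAtMost_iff)
      then show ?thesis
        using h by (simp add: gfact_eq_fact)
    qed
    then show "gnewton_poly a h n A x
        = f b + (\<Sum>k=1..n. ((u * (\<Prod>j=1..<k. u + of_nat j)) / gfact k) * gbdiff h k f b)"
      unfolding poly[OF A] by simp
  qed
  ultimately show ?thesis
    unfolding gexp_of_nat by blast
qed

end
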